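(* Let $m\ge 1$, let $n_1,\dots,n_m$ be positive integers (not necessarily distinct), and let $d=\sum_{i=1}^m n_i^2$. Let $$M=\bigoplus_{i=1}^m I_{n_i}\otimes M_{n_i}(\mathbb{C})\subseteq M_d(\mathbb{C}).$$ Then there exist two unitaries $U,V\in M$ such that $\{U^kV^k\}_{k=0}^{d-1}$ is an orthogonal basis of $M$ (as a complex vector space) under the trace inner product.
   Context: $M_n(\mathbb{C})$ denotes the algebra of complex $n\times n$ matrices and $I_n$ the $n\times n$ identity matrix. $\bigoplus_{i=1}^m I_{n_i}\otimes M_{n_i}(\mathbb{C})$ denotes the unital $*$-subalgebra of $M_d(\mathbb{C})$ consisting of all block-diagonal matrices $\bigoplus_{i=1}^m (I_{n_i}\otimes x_i)$ with $x_i\in M_{n_i}(\mathbb{C})$, where $\otimes$ is the Kronecker product. The trace inner product on $M$ is $\langle A,B\rangle=\operatorname{tr}(AB^* )$, where $\operatorname{tr}$ is the usual (unnormalized) trace on $M_d(\mathbb{C})$. *)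

theory Defs
  imports
    "Jordan_Normal_Form.VS_Connect"
    "Jordan_Normal_Form.Schur_Decomposition"
begin

definition kronecker_mat :: "'a :: semiring_0 mat \<Rightarrow> 'a mat \<Rightarrow> 'a mat" where
  "kronecker_mat A B = mat (dim_row A * dim_row B) (dim_col A * dim_col B)
     (\<lambda>(i, j). A $$ (i div dim_row B, j div dim_col B) * B $$ (i mod dim_row B, j mod dim_col B))"

definition mat_trace :: "'a :: comm_monoid_add mat \<Rightarrow> 'a" where
  "mat_trace A = (\<Sum>i<dim_row A. A $$ (i, i))"

definition unitary_mat :: "nat \<Rightarrow> complex mat \<Rightarrow> bool" where
  "unitary_mat d U \<longleftrightarrow> U \<in> carrier_mat d d \<and>
     U * mat_adjoint U = 1\<^sub>m d \<and> mat_adjoint U * U = 1\<^sub>m d"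

definition trace_inner :: "complex mat \<Rightarrow> complex mat \<Rightarrow> complex" where
  "trace_inner A B = mat_trace (A * mat_adjoint B)"

definition block_algebra :: "nat list \<Rightarrow> complex mat set" where
  "block_algebra ns =
     {diag_block_mat (map2 (\<lambda>n x. kronecker_mat (1\<^sub>m n) x) ns xs) | xs.
        list_all2 (\<lambda>n x. x \<in> carrier_mat n n) ns xs}"

(* M as a complex vector space, with the operations of the d x d matrices. *)
abbreviation mat_subspace :: "nat \<Rightarrow> complex mat set \<Rightarrow> (complex, complex mat) module" where
  "mat_subspace d M \<equiv> (module_mat TYPE(complex) d d)\<lparr>carrier := M\<rparr>"

(* Injectivity makes this a statement about the indexed family: the predicate
   vectorspace.basis only sees the set of values. *)
definition trace_orthogonal_basis ::
    "nat \<Rightarrow> complex mat set \<Rightarrow> 'i set \<Rightarrow> ('i \<Rightarrow> complex mat) \<Rightarrow> bool" where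
  "trace_orthogonal_basis d M I B \<longleftrightarrow>
     inj_on B I \<and>
     vectorspace.basis class_ring (mat_subspace d M) (B ` I) \<and>
     (\<forall>j\<in>I. \<forall>k\<in>I. j \<noteq> k \<longrightarrow> trace_inner (B j) (B k) = 0)"

lemma block_algebra_Nil: "block_algebra [] = {0\<^sub>m 0 0}"
  by (auto simp: block_algebra_def)

lemma block_algebra_Cons:
  "block_algebra (n # ns) = (\<Union>x\<in>carrier_mat n n. \<Union>B\<in>block_algebra ns.
     {four_block_mat (kronecker_mat (1\<^sub>m n) x) (0\<^sub>m (n * n) (dim_col B)) (0\<^sub>m (dim_row B) (n * n)) B})"
    (is "?L = ?R")
proof
  show "?L \<subseteq> ?R"
  proof
    fix A assume "A \<in> ?L"
    then obtain xs where xs: "list_all2 (\<lambda>n x. x \<in> carrier_mat n n) (n # ns) xs"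
      and A: "A = diag_block_mat (map2 (\<lambda>n x. kronecker_mat (1\<^sub>m n) x) (n # ns) xs)"
      by (auto simp: block_algebra_def)
    from xs obtain y ys where "xs = y # ys" "y \<in> carrier_mat n n"
      "list_all2 (\<lambda>n x. x \<in> carrier_mat n n) ns ys"
      by (auto simp: list_all2_Cons1)
    with A show "A \<in> ?R"
      by (fastforce simp: block_algebra_def Let_def kronecker_mat_def)
  qed
  show "?R \<subseteq> ?L"
  proof
    fix A assume "A \<in> ?R"
    then obtain x ys where x: "x \<in> carrier_mat n n"
      and ys: "list_all2 (\<lambda>n x. x \<in> carrier_mat n n) ns ys"
      and A: "A = (let B = diag_block_mat (map2 (\<lambda>n x. kronecker_mat (1\<^sub>m n) x) ns ys) in
        four_block_mat (kronecker_mat (1\<^sub>m n) x) (0\<^sub>m (n * n) (dim_col B)) (0\<^sub>m (dim_row B) (n * n)) B)"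
      by (auto simp: block_algebra_def Let_def)
    have "A = diag_block_mat (map2 (\<lambda>n x. kronecker_mat (1\<^sub>m n) x) (n # ns) (x # ys))"
      using A x by (simp add: Let_def kronecker_mat_def)
    moreover have "list_all2 (\<lambda>n x. x \<in> carrier_mat n n) (n # ns) (x # ys)"
      using x ys by simp
    ultimately show "A \<in> ?L" unfolding block_algebra_def by blast
  qed
qed

lemma kronecker_mat_carrier:
  "A \<in> carrier_mat a b \<Longrightarrow> B \<in> carrier_mat c e \<Longrightarrow> kronecker_mat A B \<in> carrier_mat (a * c) (b * e)"
  by (auto simp: kronecker_mat_def)

lemma block_algebra_carrier: "block_algebra ns \<subseteq> carrier_mat (\<Sum>n\<leftarrow>ns. n\<^sup>2) (\<Sum>n\<leftarrow>ns. n\<^sup>2)"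
proof (induction ns)
  case Nil
  then show ?case by (simp add: block_algebra_Nil)
next
  case (Cons n ns)
  show ?case
  proof
    fix A assume "A \<in> block_algebra (n # ns)"
    then obtain x B where "x \<in> carrier_mat n n" "B \<in> block_algebra ns" and
      "A = four_block_mat (kronecker_mat (1\<^sub>m n) x) (0\<^sub>m (n * n) (dim_col B)) (0\<^sub>m (dim_row B) (n * n)) B"
      by (auto simp: block_algebra_Cons)
    with Cons.IH show "A \<in> carrier_mat (\<Sum>n\<leftarrow>n # ns. n\<^sup>2) (\<Sum>n\<leftarrow>n # ns. n\<^sup>2)"
      by (fastforce simp: power2_eq_square kronecker_mat_def)
  qed
qed

lemma kronecker_one_zero: "kronecker_mat (1\<^sub>m n) (0\<^sub>m n n :: complex mat) = 0\<^sub>m (n * n) (n * n)"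
  by (cases "n = 0"; rule eq_matI) (auto simp: kronecker_mat_def less_mult_imp_div_less)

lemma kronecker_one_smult:
  "x \<in> carrier_mat n n \<Longrightarrow>
    c \<cdot>\<^sub>m kronecker_mat (1\<^sub>m n) x = kronecker_mat (1\<^sub>m n) (c \<cdot>\<^sub>m x :: complex mat)"
  by (cases "n = 0"; rule eq_matI) (auto simp: kronecker_mat_def less_mult_imp_div_less)

lemma kronecker_one_add:
  "x \<in> carrier_mat n n \<Longrightarrow> y \<in> carrier_mat n n \<Longrightarrow>
    kronecker_mat (1\<^sub>m n) x + kronecker_mat (1\<^sub>m n) y = kronecker_mat (1\<^sub>m n) (x + y :: complex mat)"
  by (cases "n = 0"; rule eq_matI) (auto simp: kronecker_mat_def less_mult_imp_div_less algebra_simps)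

lemma block_algebra_zero: "0\<^sub>m (\<Sum>n\<leftarrow>ns. n\<^sup>2) (\<Sum>n\<leftarrow>ns. n\<^sup>2) \<in> block_algebra ns"
proof (induction ns)
  case Nil
  then show ?case by (simp add: block_algebra_Nil)
next
  case (Cons n ns)
  let ?d = "\<Sum>n\<leftarrow>ns. n\<^sup>2"
  have "0\<^sub>m (\<Sum>n\<leftarrow>n # ns. n\<^sup>2) (\<Sum>n\<leftarrow>n # ns. n\<^sup>2) =
    four_block_mat (kronecker_mat (1\<^sub>m n) (0\<^sub>m n n)) (0\<^sub>m (n * n) (dim_col (0\<^sub>m ?d ?d :: complex mat)))
      (0\<^sub>m (dim_row (0\<^sub>m ?d ?d :: complex mat)) (n * n)) (0\<^sub>m ?d ?d :: complex mat)"
    by (simp add: kronecker_one_zero power2_eq_square)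
  with Cons.IH show ?case
    unfolding block_algebra_Cons
    by (intro UN_I[of "0\<^sub>m n n"] UN_I[of "0\<^sub>m ?d ?d"]) auto
qed

lemma block_algebra_smult: "A \<in> block_algebra ns \<Longrightarrow> c \<cdot>\<^sub>m A \<in> block_algebra ns"
proof (induction ns arbitrary: A)
  case Nil
  then show ?case by (simp add: block_algebra_Nil)
next
  case (Cons n ns)
  then obtain x B where x: "x \<in> carrier_mat n n" and B: "B \<in> block_algebra ns" and
    A: "A = four_block_mat (kronecker_mat (1\<^sub>m n) x) (0\<^sub>m (n * n) (dim_col B)) (0\<^sub>m (dim_row B) (n * n)) B"
    by (auto simp: block_algebra_Cons)
  have "c \<cdot>\<^sub>m A = four_block_mat (kronecker_mat (1\<^sub>m n) (c \<cdot>\<^sub>m x)) (0\<^sub>m (n * n) (dim_col (c \<cdot>\<^sub>m B)))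
    (0\<^sub>m (dim_row (c \<cdot>\<^sub>m B)) (n * n)) (c \<cdot>\<^sub>m B)"
    unfolding A
    by (subst smult_four_block_mat[of _ "n * n" "n * n" _ "dim_col B" _ "dim_row B"])
      (use x in \<open>auto simp: kronecker_one_smult kronecker_mat_carrier\<close>)
  with x Cons.IH[OF B] show ?case
    unfolding block_algebra_Cons by (intro UN_I[of "c \<cdot>\<^sub>m x"] UN_I[of "c \<cdot>\<^sub>m B"]) auto
qed

lemma block_algebra_add:
  "A \<in> block_algebra ns \<Longrightarrow> A' \<in> block_algebra ns \<Longrightarrow> A + A' \<in> block_algebra ns"
proof (induction ns arbitrary: A A')
  case Nil
  then show ?case by (simp add: block_algebra_Nil)
next
  case (Cons n ns)
  from Cons.prems(1) obtain x B where x: "x \<in> carrier_mat n n" and B: "B \<in> block_algebra ns" and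
    A: "A = four_block_mat (kronecker_mat (1\<^sub>m n) x) (0\<^sub>m (n * n) (dim_col B)) (0\<^sub>m (dim_row B) (n * n)) B"
    by (auto simp: block_algebra_Cons)
  from Cons.prems(2) obtain y C where y: "y \<in> carrier_mat n n" and C: "C \<in> block_algebra ns" and
    A': "A' = four_block_mat (kronecker_mat (1\<^sub>m n) y) (0\<^sub>m (n * n) (dim_col C)) (0\<^sub>m (dim_row C) (n * n)) C"
    by (auto simp: block_algebra_Cons)
  let ?d = "\<Sum>n\<leftarrow>ns. n\<^sup>2"
  have BC: "B \<in> carrier_mat ?d ?d" "C \<in> carrier_mat ?d ?d"
    using B C block_algebra_carrier by blast+
  have dims: "dim_row B = ?d" "dim_col B = ?d" "dim_row C = ?d" "dim_col C = ?d"
    using BC by auto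
  have "A + A' = four_block_mat (kronecker_mat (1\<^sub>m n) (x + y)) (0\<^sub>m (n * n) (dim_col (B + C)))
    (0\<^sub>m (dim_row (B + C)) (n * n)) (B + C)"
    unfolding A A' index_add_mat dims
    by (subst add_four_block_mat[of _ "n * n" "n * n" _ ?d _ ?d])
      (use x y BC in \<open>auto simp: kronecker_one_add kronecker_mat_carrier\<close>)
  with x y Cons.IH[OF B C] show ?case
    unfolding block_algebra_Cons by (intro UN_I[of "x + y"] UN_I[of "B + C"]) auto
qed

(* vectorspace.basis is only meaningful on an actual vector space. *)
lemma vectorspace_block_algebra:
  assumes "d = (\<Sum>n\<leftarrow>ns. n\<^sup>2)"
  shows "vectorspace class_ring (mat_subspace d (block_algebra ns))"
proof (rule vectorspace.subspace_is_vs[OF matrix_vs])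
  show "VectorSpace.subspace class_ring (block_algebra ns) (module_mat TYPE(complex) d d)"
    unfolding VectorSpace.subspace_def submodule_def
    using matrix_vs[of d d, where 'a = complex] block_algebra_carrier[of ns]
      block_algebra_zero[of ns] assms
    by (auto simp: vectorspace_def module_mat_simps block_algebra_add block_algebra_smult)
qed

end

theory Submission
  imports Defs
begin

text \<open>
  Put \<open>\<omega> = cis (2\<pi>/d)\<close> and suppose that \<open>R\<^sub>0, \<dots>, R\<^sub>d\<^sub>-\<^sub>1\<close> is an orthonormal basis of the block algebra
  \<open>M\<close> such that \<open>U\<^sup>k V\<^sup>k = \<Sum>\<^sub>c \<omega>\<^sup>k\<^sup>c R\<^sub>c\<close> for every \<open>k\<close>. The products \<open>U\<^sup>k V\<^sup>k\<close> with \<open>k < d\<close> then arise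
  from an orthonormal basis by the discrete Fourier transform of order \<open>d\<close>, which is invertible and
  multiplies inner products by \<open>d\<close>, so they form an orthogonal basis
  (\<open>fourier_transform_orthogonal_basis\<close>).

  To obtain such a pair in one block \<open>I\<^sub>n \<otimes> M\<^sub>n\<close>, let \<open>P\<^sub>a\<close> be the projections onto the standard basis
  vectors and \<open>Q\<^sub>b\<close> those onto the vectors of the Fourier basis of dimension \<open>n\<close>. Take
  \<open>U = \<Sum>\<^sub>a \<omega>\<^sup>s\<^sup>+\<^sup>a P\<^sub>a\<close> and \<open>V = \<Sum>\<^sub>b \<omega>\<^sup>b\<^sup>n Q\<^sub>b\<close>, where \<open>s\<close> is an offset. Then
  \<open>U\<^sup>k V\<^sup>k = \<Sum> \<omega>\<^sup>k\<^sup>(\<^sup>s\<^sup>+\<^sup>a\<^sup>+\<^sup>b\<^sup>n\<^sup>) P\<^sub>a Q\<^sub>b\<close>, and by division with remainder \<open>a + bn\<close> runs exactly once through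
  \<open>0, \<dots>, n\<^sup>2 - 1\<close>. The two bases are mutually unbiased, so the \<open>n\<^sup>2\<close> matrices \<open>P\<^sub>a Q\<^sub>b\<close> are pairwise
  orthogonal of squared norm \<open>1/n\<close>, and the multiplicity \<open>n\<close> of the block normalises them
  (\<open>fourier_pair_ampliation\<close>).

  A block of size \<open>n\<close> thus uses up the exponents in an interval of length \<open>n\<^sup>2\<close>. Since
  \<open>d = \<Sum>\<^sub>i n\<^sub>i\<^sup>2\<close>, the offsets can be chosen so that these intervals tile \<open>{0, \<dots>, d - 1}\<close>; the direct sum
  of the pairs then has the required form (\<open>fourier_pair_direct_sum\<close>).
\<close>

section \<open>Characters of finite cyclic groups\<close>

definition cyc_char :: "nat \<Rightarrow> nat \<Rightarrow> nat \<Rightarrow> complex" where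
  "cyc_char n b p = cis (2 * pi / real n) ^ (b * p)"

lemma cyc_char_commute: "cyc_char n b p = cyc_char n p b"
  by (simp add: cyc_char_def mult.commute)

lemma cyc_char_cnj [simp]: "cyc_char n b p * cnj (cyc_char n b p) = 1"
  by (simp add: cyc_char_def DeMoivre cis_cnj cis_mult)

lemma cyc_char_orthogonal_less:
  assumes "j < k" "k < n"
  shows "(\<Sum>b<n. cyc_char n b k * cnj (cyc_char n b j)) = 0"
proof -
  define z where "z = cis (2 * pi * real (k - j) / real n)"
  have "cis (2 * pi / real n) ^ k = z * cis (2 * pi / real n) ^ j"
    using assms by (simp add: z_def DeMoivre cis_mult of_nat_diff field_simps)
  hence "cyc_char n b k * cnj (cyc_char n b j) = z ^ b" for b
    using cyc_char_cnj[of n b j]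
    by (simp add: cyc_char_def power_mult mult.commute[of b] power_mult_distrib mult.assoc)
  moreover have "(\<Sum>b<n. z ^ b) = 0"
  proof -
    have "z \<noteq> 1"
    proof
      assume "z = 1"
      hence "cis (2 * pi * real (k - j) / real n) = cis (2 * pi * real 0 / real n)"
        by (simp add: z_def)
      moreover have inj: "inj_on (\<lambda>k. cis (2 * pi * real k / real n)) {..<n}"
        using bij_betw_roots_unity[of n] assms by (auto simp: bij_betw_def)
      ultimately have "k - j = 0"
        using assms by (intro inj_onD[OF inj]) auto
      thus False using assms by simp
    qed
    moreover have "z ^ n = 1"
      using assms cis_multiple_2pi[of "real (k - j)"] by (simp add: z_def DeMoivre)
    ultimately show ?thesis by (simp add: geometric_sum)
  qed
  ultimately show ?thesis by simp
qed

lemma cyc_char_orthogonal: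
  assumes "j < n" "k < n"
  shows "(\<Sum>b<n. cyc_char n b k * cnj (cyc_char n b j)) = (if k = j then of_nat n else 0)"
proof (cases j k rule: linorder_cases)
  case less
  thus ?thesis using cyc_char_orthogonal_less assms by simp
next
  case equal
  thus ?thesis by simp
next
  case greater
  have "(\<Sum>b<n. cyc_char n b k * cnj (cyc_char n b j))
      = cnj (\<Sum>b<n. cyc_char n b j * cnj (cyc_char n b k))"
    by (simp add: mult.commute)
  thus ?thesis using cyc_char_orthogonal_less[OF greater assms(1)] greater by simp
qed

section \<open>The trace inner product in coordinates\<close>

lemma mat_adjoint_index [simp]:
  fixes A :: "complex mat"
  shows "i < dim_col A \<Longrightarrow> j < dim_row A \<Longrightarrow> mat_adjoint A $$ (i, j) = cnj (A $$ (j, i))"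
  by (simp add: mat_adjoint_def mat_of_rows_index)

lemma mat_adjoint_dim [simp]:
  fixes A :: "complex mat"
  shows "dim_row (mat_adjoint A) = dim_col A" "dim_col (mat_adjoint A) = dim_row A"
  by (simp_all add: mat_adjoint_def)

lemma trace_inner_entries:
  assumes "A \<in> carrier_mat N N" "B \<in> carrier_mat N N"
  shows "trace_inner A B = (\<Sum>p<N. \<Sum>q<N. A $$ (p, q) * cnj (B $$ (p, q)))"
  using assms
  by (auto simp: trace_inner_def mat_trace_def scalar_prod_def atLeast0LessThan intro!: sum.cong)

lemma trace_inner_cnj:
  assumes "A \<in> carrier_mat N N" "B \<in> carrier_mat N N"
  shows "trace_inner B A = cnj (trace_inner A B)"
  using assms by (simp add: trace_inner_entries[of _ N] mult.commute)

text \<open>\<open>X\<close> is the combination \<open>\<Sum>\<^sub>c x\<^sub>c R\<^sub>c\<close>, read entry by entry on the leading \<open>N \<times> N\<close> square. This keeps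
  all sums over complex numbers and avoids sums in the matrix monoid, which depend on the dimension.\<close>

definition combines_to ::
    "nat \<Rightarrow> nat \<Rightarrow> (nat \<Rightarrow> complex) \<Rightarrow> (nat \<Rightarrow> complex mat) \<Rightarrow> complex mat \<Rightarrow> bool" where
  "combines_to N m x R X \<longleftrightarrow> (\<forall>p<N. \<forall>q<N. X $$ (p, q) = (\<Sum>c<m. x c * R c $$ (p, q)))"

lemma trace_inner_combination:
  assumes X: "combines_to N m x R X"
    and "X \<in> carrier_mat N N" "\<And>c. c < m \<Longrightarrow> R c \<in> carrier_mat N N" "B \<in> carrier_mat N N"
  shows "trace_inner X B = (\<Sum>c<m. x c * trace_inner (R c) B)"
proof -
  have "trace_inner X B = (\<Sum>p<N. \<Sum>q<N. \<Sum>c<m. x c * R c $$ (p, q) * cnj (B $$ (p, q)))"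
    using X assms(2,4) by (simp add: trace_inner_entries[of _ N] combines_to_def sum_distrib_right)
  also have "\<dots> = (\<Sum>p<N. \<Sum>c<m. \<Sum>q<N. x c * R c $$ (p, q) * cnj (B $$ (p, q)))"
    by (intro sum.cong refl sum.swap)
  also have "\<dots> = (\<Sum>c<m. \<Sum>p<N. \<Sum>q<N. x c * R c $$ (p, q) * cnj (B $$ (p, q)))"
    by (rule sum.swap)
  also have "\<dots> = (\<Sum>c<m. x c * trace_inner (R c) B)"
    using assms(3,4)
    by (intro sum.cong refl) (simp add: trace_inner_entries[of _ N] sum_distrib_left mult.assoc)
  finally show ?thesis .
qed

definition orthonormal_frame :: "nat \<Rightarrow> complex mat set \<Rightarrow> (nat \<Rightarrow> complex mat) \<Rightarrow> bool" where
  "orthonormal_frame N M R \<longleftrightarrow>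
     (\<forall>c<N. R c \<in> M) \<and>
     (\<forall>c<N. \<forall>c'<N. trace_inner (R c) (R c') = (if c = c' then 1 else 0)) \<and>
     (\<forall>X\<in>M. \<exists>x. combines_to N N x R X)"

section \<open>The Fourier transform of an orthonormal basis\<close>

lemma lincomb_mat_entry:
  assumes M: "M \<subseteq> carrier_mat d d" and vs: "vectorspace class_ring (mat_subspace d M)"
    and "finite S" "S \<subseteq> M" "p < d" "q < d"
  shows "module.lincomb (mat_subspace d M) a S $$ (p, q) = (\<Sum>A\<in>S. a A * A $$ (p, q))"
  using assms(3,4)
proof (induction S rule: finite_induct)
  case empty
  interpret vectorspace class_ring "mat_subspace d M" by fact
  show ?case using assms by (simp add: lincomb_def module_mat_simps)
next
  case (insert A S)
  interpret vectorspace class_ring "mat_subspace d M" by fact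
  have "lincomb a S \<in> carrier (mat_subspace d M)"
    using insert.prems by (intro lincomb_closed) (auto simp: class_ring_simps)
  hence "lincomb a S \<in> carrier_mat d d" using M by auto
  moreover have "lincomb a (insert A S) = a A \<cdot>\<^sub>m A + lincomb a S"
    using lincomb_insert[of S a A] insert.hyps insert.prems
    by (simp add: module_mat_simps class_ring_simps)
  moreover have "A \<in> carrier_mat d d" using insert.prems M by auto
  ultimately show ?case
    using insert assms(5,6) by simp
qed

text \<open>Expanding both arguments in the frame turns \<open>\<langle>B\<^sub>j, B\<^sub>k\<rangle>\<close> into the inner product of two characters
  of order \<open>d\<close>, which is \<open>d\<close> or \<open>0\<close>. This gives injectivity and linear independence. The
  family spans because Fourier inversion recovers the frame from it.\<close>

lemma fourier_transform_orthogonal_basis: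
  assumes M: "M \<subseteq> carrier_mat d d" and vs: "vectorspace class_ring (mat_subspace d M)"
    and R: "orthonormal_frame d M R"
    and B: "\<And>k. B k \<in> M" "\<And>k. combines_to d d (cyc_char d k) R (B k)"
  shows "trace_orthogonal_basis d M {0..<d} B"
proof -
  interpret vectorspace class_ring "mat_subspace d M" by fact
  have RM: "R c \<in> carrier_mat d d" if "c < d" for c
    using R M that by (auto simp: orthonormal_frame_def)
  have BM: "B k \<in> carrier_mat d d" for k using B M by auto
  have BR: "trace_inner (B j) (R c) = cyc_char d j c" if "c < d" for j c
    using R that RM BM B(2)
    by (subst trace_inner_combination[of d d "cyc_char d j" R])
      (auto simp: orthonormal_frame_def if_distrib[of "\<lambda>x. _ * x"] cong: if_cong)
  have BB: "trace_inner (B j) (B k) = (if j = k then of_nat d else 0)" if "j < d" "k < d" for j k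
  proof -
    have "trace_inner (B j) (B k) = (\<Sum>c<d. cyc_char d j c * trace_inner (R c) (B k))"
      using RM BM B(2) by (intro trace_inner_combination) auto
    also have "\<dots> = (\<Sum>c<d. cyc_char d c j * cnj (cyc_char d c k))"
      using RM BM BR
      by (intro sum.cong refl)
        (simp add: trace_inner_cnj[of "B k" d "R _"] cyc_char_commute[of d _ j] cyc_char_commute[of d _ k])
    finally show ?thesis using cyc_char_orthogonal[OF that(2,1)] by simp
  qed
  have inj: "inj_on B {0..<d}"
  proof (rule inj_onI, rule ccontr)
    fix j k assume "j \<in> {0..<d}" "k \<in> {0..<d}" "B j = B k" "j \<noteq> k"
    thus False using BB[of j k] BB[of j j] by auto
  qed
  have sub: "B ` {0..<d} \<subseteq> carrier (mat_subspace d M)" using B by auto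
  have comb: "combines_to d d (\<lambda>k. a (B k)) B (lincomb a (B ` {0..<d}))" for a
    unfolding combines_to_def
  proof (intro allI impI)
    fix p q assume "p < d" "q < d"
    hence "lincomb a (B ` {0..<d}) $$ (p, q) = (\<Sum>A\<in>B ` {0..<d}. a A * A $$ (p, q))"
      using sub by (intro lincomb_mat_entry[OF M vs]) auto
    also have "\<dots> = (\<Sum>k\<in>{0..<d}. a (B k) * B k $$ (p, q))"
      by (simp add: sum.reindex[OF inj])
    finally show "lincomb a (B ` {0..<d}) $$ (p, q) = (\<Sum>k<d. a (B k) * B k $$ (p, q))"
      by (simp add: atLeast0LessThan)
  qed
  have "lin_indpt (B ` {0..<d})"
  proof (rule finite_lin_indpt2[OF _ sub])
    fix a :: "complex mat \<Rightarrow> complex"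
    assume z: "lincomb a (B ` {0..<d}) = \<zero>\<^bsub>mat_subspace d M\<^esub>"
    show "\<forall>v\<in>B ` {0..<d}. a v = \<zero>\<^bsub>class_ring\<^esub>"
    proof safe
      fix k assume k: "k \<in> {0..<d}"
      have "trace_inner (0\<^sub>m d d) (B k) = (\<Sum>j<d. a (B j) * trace_inner (B j) (B k))"
        using comb[of a] BM unfolding z
        by (intro trace_inner_combination) (auto simp: module_mat_simps)
      also have "\<dots> = (\<Sum>j<d. if j = k then a (B k) * of_nat d else 0)"
        using k by (intro sum.cong refl) (auto simp: BB)
      finally have "a (B k) * of_nat d = 0"
        using k BM by (simp add: trace_inner_entries[of _ d])
      thus "a (B k) = \<zero>\<^bsub>class_ring\<^esub>" using k by (simp add: class_ring_simps)
    qed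
  qed simp
  moreover have "span (B ` {0..<d}) = carrier (mat_subspace d M)"
  proof
    show "span (B ` {0..<d}) \<subseteq> carrier (mat_subspace d M)"
      using sub by (rule span_is_subset2)
    show "carrier (mat_subspace d M) \<subseteq> span (B ` {0..<d})"
    proof
      fix X assume "X \<in> carrier (mat_subspace d M)"
      hence XM: "X \<in> M" by simp
      then obtain x where x: "combines_to d d x R X"
        using R by (auto simp: orthonormal_frame_def)
      \<comment> \<open>The coefficients of \<open>X\<close> come from \<open>x\<close> by the inverse Fourier transform.\<close>
      define y where "y k = (\<Sum>c<d. x c * cnj (cyc_char d k c)) / of_nat d" for k
      define a where "a A = y (the_inv_into {0..<d} B A)" for A
      have aB: "a (B k) = y k" if "k < d" for k
        using that inj by (simp add: a_def the_inv_into_f_f)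
      have "lincomb a (B ` {0..<d}) \<in> carrier (mat_subspace d M)"
        using sub by (intro lincomb_closed) (auto simp: class_ring_simps)
      hence L: "lincomb a (B ` {0..<d}) \<in> carrier_mat d d" using M by auto
      have "X = lincomb a (B ` {0..<d})"
      proof (rule eq_matI)
        fix p q assume "p < dim_row (lincomb a (B ` {0..<d}))" "q < dim_col (lincomb a (B ` {0..<d}))"
        hence pq: "p < d" "q < d" using L by auto
        have "lincomb a (B ` {0..<d}) $$ (p, q) = (\<Sum>k<d. y k * B k $$ (p, q))"
          using comb[of a] pq aB by (simp add: combines_to_def)
        also have "\<dots> = (\<Sum>k<d. y k * (\<Sum>c<d. cyc_char d k c * R c $$ (p, q)))"
          using B(2) pq by (simp add: combines_to_def)
        also have "\<dots> = (\<Sum>k<d. \<Sum>c<d. y k * cyc_char d k c * R c $$ (p, q))"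
          by (simp add: sum_distrib_left mult.assoc)
        also have "\<dots> = (\<Sum>c<d. \<Sum>k<d. y k * cyc_char d k c * R c $$ (p, q))"
          by (rule sum.swap)
        also have "\<dots> = (\<Sum>c<d. x c * R c $$ (p, q))"
        proof (rule sum.cong[OF refl])
          fix c assume "c \<in> {..<d}"
          hence c: "c < d" by simp
          have "(\<Sum>k<d. y k * cyc_char d k c)
              = (\<Sum>k<d. \<Sum>c'<d. x c' * (cyc_char d k c * cnj (cyc_char d k c'))) / of_nat d"
            by (simp add: y_def sum_distrib_left sum_distrib_right sum_divide_distrib mult_ac)
          also have "(\<Sum>k<d. \<Sum>c'<d. x c' * (cyc_char d k c * cnj (cyc_char d k c')))
              = (\<Sum>c'<d. x c' * (\<Sum>k<d. cyc_char d k c * cnj (cyc_char d k c')))"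
            by (subst sum.swap) (simp add: sum_distrib_left)
          also have "\<dots> = (\<Sum>c'<d. if c' = c then x c * of_nat d else 0)"
            using c by (intro sum.cong refl) (auto simp: cyc_char_orthogonal)
          also have "\<dots> = x c * of_nat d" using c by simp
          finally have "(\<Sum>k<d. y k * cyc_char d k c) = x c" using c by simp
          thus "(\<Sum>k<d. y k * cyc_char d k c * R c $$ (p, q)) = x c * R c $$ (p, q)"
            by (simp add: sum_distrib_right[symmetric])
        qed
        also have "\<dots> = X $$ (p, q)" using x pq by (simp add: combines_to_def)
        finally show "X $$ (p, q) = lincomb a (B ` {0..<d}) $$ (p, q)" by simp
      qed (use L XM M in auto)
      thus "X \<in> span (B ` {0..<d})"
        using finite_span[OF _ sub] by (auto simp: class_ring_simps)
    qed
  qed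
  ultimately show ?thesis
    using inj sub BB by (auto simp: trace_orthogonal_basis_def basis_def)
qed


section \<open>Splitting index ranges\<close>

lemma sum_lessThan_add:
  fixes f :: "nat \<Rightarrow> 'a :: comm_monoid_add"
  shows "(\<Sum>i<a + b. f i) = (\<Sum>i<a. f i) + (\<Sum>i<b. f (a + i))"
  by (induction b) (simp_all add: add.assoc)

lemma sum_lessThan_divmod:
  fixes g :: "nat \<Rightarrow> nat \<Rightarrow> 'a :: comm_monoid_add"
  assumes "n > 0"
  shows "(\<Sum>i<m * n. g (i div n) (i mod n)) = (\<Sum>a<m. \<Sum>b<n. g a b)"
proof (induction m)
  case (Suc m)
  have "(\<Sum>i<Suc m * n. g (i div n) (i mod n)) = (\<Sum>i<m * n + n. g (i div n) (i mod n))"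
    by (simp add: add.commute)
  also have "\<dots> = (\<Sum>a<m. \<Sum>b<n. g a b) + (\<Sum>b<n. g m b)"
    unfolding sum_lessThan_add Suc using assms by simp
  finally show ?case by simp
qed simp

section \<open>Diagonal matrices and Fourier multipliers\<close>

lemma cyc_char_add: "cyc_char d k (x + y) = cyc_char d k x * cyc_char d k y"
  by (simp add: cyc_char_def distrib_left power_add)

lemma cyc_char_power: "cyc_char d 1 p ^ k = cyc_char d k p"
  by (simp add: cyc_char_def mult.commute[of k] flip: power_mult)

lemma mat_diag_power: "mat_diag n f ^\<^sub>m k = mat_diag n (\<lambda>i. f i ^ k)"
  by (induction k) (simp_all add: carrier_matD(1)[OF mat_diag_dim] power_commutes)

lemma mat_adjoint_diag: "mat_adjoint (mat_diag n f) = mat_diag n (\<lambda>i. cnj (f i))"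
  by (rule eq_matI) (auto simp: mat_diag_def)

lemma unitary_mat_diag:
  assumes "\<And>i. f i * cnj (f i) = 1"
  shows "unitary_mat n (mat_diag n f)"
  using assms by (simp add: unitary_mat_def mat_adjoint_diag mult.commute)

text \<open>\<open>F diag(e) F\<^sup>*\<close> for the unitary Fourier matrix \<open>F\<close> of order \<open>n\<close>, that is \<open>\<Sum>\<^sub>b e\<^sub>b Q\<^sub>b\<close>. The two
  factors \<open>1/\<surd>n\<close> of \<open>F\<close> and \<open>F\<^sup>*\<close> are merged into the division by \<open>n\<close>.\<close>

definition fourier_multiplier :: "nat \<Rightarrow> (nat \<Rightarrow> complex) \<Rightarrow> complex mat" where
  "fourier_multiplier n e =
     mat n n (\<lambda>(p, q). (\<Sum>b<n. e b * cyc_char n b p * cnj (cyc_char n b q)) / of_nat n)"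

lemma fourier_multiplier_carrier [simp]: "fourier_multiplier n e \<in> carrier_mat n n"
  by (simp add: fourier_multiplier_def)

lemma fourier_multiplier_dim [simp]:
  "dim_row (fourier_multiplier n e) = n" "dim_col (fourier_multiplier n e) = n"
  by (simp_all add: fourier_multiplier_def)

lemma fourier_multiplier_one: "fourier_multiplier n (\<lambda>_. 1) = 1\<^sub>m n"
  by (rule eq_matI) (auto simp: fourier_multiplier_def cyc_char_orthogonal)

lemma fourier_multiplier_mult:
  "fourier_multiplier n e * fourier_multiplier n f = fourier_multiplier n (\<lambda>b. e b * f b)"
proof (rule eq_matI)
  fix p q assume "p < dim_row (fourier_multiplier n (\<lambda>b. e b * f b))"
    "q < dim_col (fourier_multiplier n (\<lambda>b. e b * f b))"
  hence pq: "p < n" "q < n" by auto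
  let ?c = "cyc_char n"
  have "(fourier_multiplier n e * fourier_multiplier n f) $$ (p, q)
     = (\<Sum>i<n. (\<Sum>b<n. e b * ?c b p * cnj (?c b i)) / of_nat n
          * ((\<Sum>b'<n. f b' * ?c b' i * cnj (?c b' q)) / of_nat n))"
    using pq by (simp add: fourier_multiplier_def scalar_prod_def atLeast0LessThan)
  also have "\<dots> = (\<Sum>i<n. \<Sum>b<n. \<Sum>b'<n. e b * ?c b p * f b' * cnj (?c b' q)
          * (?c i b' * cnj (?c i b))) / (of_nat n * of_nat n)"
    by (simp add: sum_product sum_divide_distrib mult_ac cyc_char_commute[of n _ "_ :: nat"])
  also have "(\<Sum>i<n. \<Sum>b<n. \<Sum>b'<n. e b * ?c b p * f b' * cnj (?c b' q) * (?c i b' * cnj (?c i b)))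
     = (\<Sum>b<n. \<Sum>b'<n. e b * ?c b p * f b' * cnj (?c b' q) * (\<Sum>i<n. ?c i b' * cnj (?c i b)))"
    by (subst sum.swap, rule sum.cong[OF refl], subst sum.swap) (simp add: sum_distrib_left)
  also have "\<dots> = (\<Sum>b<n. \<Sum>b'<n. if b' = b then e b * ?c b p * f b * cnj (?c b q) * of_nat n else 0)"
    by (intro sum.cong refl) (auto simp: cyc_char_orthogonal)
  also have "\<dots> = (\<Sum>b<n. e b * f b * ?c b p * cnj (?c b q)) * of_nat n"
    by (simp add: sum_distrib_right mult.commute[of "f _"] mult.assoc)
  finally show "(fourier_multiplier n e * fourier_multiplier n f) $$ (p, q)
      = fourier_multiplier n (\<lambda>b. e b * f b) $$ (p, q)"
    using pq by (simp add: fourier_multiplier_def)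
qed auto

lemma fourier_multiplier_power:
  "fourier_multiplier n e ^\<^sub>m k = fourier_multiplier n (\<lambda>b. e b ^ k)"
  by (induction k) (simp_all add: fourier_multiplier_one fourier_multiplier_mult mult.commute)

lemma mat_adjoint_fourier_multiplier:
  "mat_adjoint (fourier_multiplier n e) = fourier_multiplier n (\<lambda>b. cnj (e b))"
  by (rule eq_matI) (auto simp: fourier_multiplier_def mult_ac)

lemma unitary_fourier_multiplier:
  assumes "\<And>i. e i * cnj (e i) = 1"
  shows "unitary_mat n (fourier_multiplier n e)"
  using assms
  by (simp add: unitary_mat_def mat_adjoint_fourier_multiplier fourier_multiplier_mult
      fourier_multiplier_one mult.commute)

section \<open>Products of standard and Fourier projections\<close>

text \<open>The product \<open>P\<^sub>a Q\<^sub>b\<close>, numbered by \<open>c = a + bn\<close>: the row \<open>a\<close> of \<open>Q\<^sub>b\<close>, with zeros elsewhere.\<close>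

definition fourier_unit :: "nat \<Rightarrow> nat \<Rightarrow> complex mat" where
  "fourier_unit n c = mat n n (\<lambda>(p, q). if p = c mod n
     then cyc_char n (c div n) p * cnj (cyc_char n (c div n) q) / of_nat n else 0)"

lemma fourier_unit_carrier [simp]: "fourier_unit n c \<in> carrier_mat n n"
  by (simp add: fourier_unit_def)

lemma sum_fourier_unit:
  assumes "p < n" "q < n"
  shows "(\<Sum>c<n * n. x c * fourier_unit n c $$ (p, q))
    = (\<Sum>b<n. x (b * n + p) * cyc_char n b p * cnj (cyc_char n b q)) / of_nat n"
proof -
  have "(\<Sum>c<n * n. x c * fourier_unit n c $$ (p, q))
    = (\<Sum>c<n * n. (\<lambda>b a. x (b * n + a) * (if p = a
        then cyc_char n b p * cnj (cyc_char n b q) / of_nat n else 0)) (c div n) (c mod n))"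
    using assms by (intro sum.cong refl) (auto simp: fourier_unit_def)
  also have "\<dots> = (\<Sum>b<n. \<Sum>a<n. x (b * n + a) * (if p = a
        then cyc_char n b p * cnj (cyc_char n b q) / of_nat n else 0))"
    using assms by (intro sum_lessThan_divmod) auto
  also have "\<dots> = (\<Sum>b<n. \<Sum>a<n. if p = a
        then x (b * n + p) * cyc_char n b p * cnj (cyc_char n b q) / of_nat n else 0)"
    by (intro sum.cong refl) auto
  finally show ?thesis using assms by (simp add: sum_divide_distrib)
qed

text \<open>Row \<open>a\<close> of \<open>X\<close> is expanded in the Fourier basis. The rows of \<open>P\<^sub>a Q\<^sub>b\<close> are the conjugated basis
  vectors scaled by the phase of their entry \<open>a\<close>, and the coefficient must undo that phase.\<close>

lemma fourier_unit_spans: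
  assumes "X \<in> carrier_mat n n"
  shows "\<exists>x. combines_to n (n * n) x (fourier_unit n) X"
proof
  let ?c = "cyc_char n"
  define x where "x c = (\<Sum>r<n. X $$ (c mod n, r) * ?c (c div n) r) * cnj (?c (c div n) (c mod n))" for c
  show "combines_to n (n * n) x (fourier_unit n) X"
    unfolding combines_to_def
  proof (intro allI impI)
    fix p q assume pq: "p < n" "q < n"
    have "(\<Sum>b<n. x (b * n + p) * ?c b p * cnj (?c b q))
        = (\<Sum>b<n. (\<Sum>r<n. X $$ (p, r) * ?c b r) * (?c b p * cnj (?c b p)) * cnj (?c b q))"
      using pq by (intro sum.cong refl) (simp add: x_def mult_ac del: cyc_char_cnj)
    also have "\<dots> = (\<Sum>b<n. \<Sum>r<n. X $$ (p, r) * (?c b r * cnj (?c b q)))"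
      by (simp add: sum_distrib_right mult.assoc)
    also have "\<dots> = (\<Sum>r<n. X $$ (p, r) * (\<Sum>b<n. ?c b r * cnj (?c b q)))"
      by (subst sum.swap) (simp add: sum_distrib_left)
    also have "\<dots> = (\<Sum>r<n. if r = q then X $$ (p, q) * of_nat n else 0)"
      using pq by (intro sum.cong refl) (auto simp: cyc_char_orthogonal)
    also have "\<dots> = X $$ (p, q) * of_nat n" using pq by simp
    finally show "X $$ (p, q) = (\<Sum>c<n * n. x c * fourier_unit n c $$ (p, q))"
      using pq by (simp add: sum_fourier_unit)
  qed
qed

text \<open>Distinct \<open>a\<close> give disjoint rows. Within one row, distinct \<open>b\<close> give orthogonal characters. The
  squared norm is \<open>n\<close> entries of squared modulus \<open>1/n\<^sup>2\<close>, because all entries of the Fourier matrix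
  have equal modulus.\<close>

lemma trace_inner_fourier_unit:
  assumes "c < n * n" "c' < n * n"
  shows "trace_inner (fourier_unit n c) (fourier_unit n c') = (if c = c' then 1 / of_nat n else 0)"
proof -
  let ?c = "cyc_char n"
  define a b a' b' where ab: "a = c mod n" "b = c div n" "a' = c' mod n" "b' = c' div n"
  have n: "n > 0" using assms by (cases n) auto
  have bn: "b < n" "b' < n" "a < n" using assms n by (auto simp: ab less_mult_imp_div_less)
  have "trace_inner (fourier_unit n c) (fourier_unit n c')
     = (\<Sum>p<n. \<Sum>q<n. fourier_unit n c $$ (p, q) * cnj (fourier_unit n c' $$ (p, q)))"
    by (rule trace_inner_entries) auto
  also have "\<dots> = (\<Sum>p<n. if p = a then if a = a' then
        (\<Sum>q<n. ?c b a * cnj (?c b' a) * (?c q b' * cnj (?c q b))) / (of_nat n * of_nat n) else 0 else 0)"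
    by (rule sum.cong[OF refl])
      (auto simp: fourier_unit_def ab[symmetric] sum_divide_distrib mult_ac
        cyc_char_commute[of n b] cyc_char_commute[of n b'])
  also have "\<dots> = (if a = a' then ?c b a * cnj (?c b' a) * (\<Sum>q<n. ?c q b' * cnj (?c q b))
       / (of_nat n * of_nat n) else 0)"
    using bn by (simp add: sum_distrib_left)
  also have "\<dots> = (if a = a' \<and> b = b' then 1 / of_nat n else 0)"
    using bn n by (auto simp: cyc_char_orthogonal)
  also have "a = a' \<and> b = b' \<longleftrightarrow> c = c'"
    unfolding ab by (metis div_mult_mod_eq)
  finally show ?thesis .
qed

text \<open>The phase of \<open>P\<^sub>a Q\<^sub>b\<close> in \<open>U\<^sup>k V\<^sup>k\<close> is the product of those of \<open>P\<^sub>a\<close> and \<open>Q\<^sub>b\<close>, so the exponents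
  \<open>s + a\<close> and \<open>bn\<close> add up to \<open>s + c\<close>.\<close>

lemma diag_fourier_powers:
  "mat_diag n (\<lambda>a. cyc_char d 1 (s + a)) ^\<^sub>m k * fourier_multiplier n (\<lambda>b. cyc_char d 1 (b * n)) ^\<^sub>m k
    \<in> carrier_mat n n" (is "?X \<in> _")
  "combines_to n (n * n) (\<lambda>c. cyc_char d k (s + c)) (fourier_unit n)
     (mat_diag n (\<lambda>a. cyc_char d 1 (s + a)) ^\<^sub>m k * fourier_multiplier n (\<lambda>b. cyc_char d 1 (b * n)) ^\<^sub>m k)"
proof -
  have X: "?X = mat n n (\<lambda>(p, q). cyc_char d k (s + p)
      * fourier_multiplier n (\<lambda>b. cyc_char d k (b * n)) $$ (p, q))"
    unfolding mat_diag_power fourier_multiplier_power cyc_char_power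
    by (rule mat_diag_mult_left) simp
  thus "?X \<in> carrier_mat n n" by simp
  show "combines_to n (n * n) (\<lambda>c. cyc_char d k (s + c)) (fourier_unit n) ?X"
    unfolding combines_to_def
  proof (intro allI impI)
    fix p q assume pq: "p < n" "q < n"
    show "?X $$ (p, q) = (\<Sum>c<n * n. cyc_char d k (s + c) * fourier_unit n c $$ (p, q))"
      unfolding sum_fourier_unit[OF pq] X using pq
      by (simp add: fourier_multiplier_def cyc_char_add sum_distrib_left mult_ac)
  qed
qed

section \<open>Ampliation of a full matrix algebra\<close>

lemma kronecker_one_dim [simp]:
  "dim_row (kronecker_mat (1\<^sub>m n) x) = n * dim_row x"
  "dim_col (kronecker_mat (1\<^sub>m n) x) = n * dim_col x"
  by (simp_all add: kronecker_mat_def)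

lemma kronecker_one_index:
  fixes x :: "complex mat"
  assumes "x \<in> carrier_mat n n" "p < n * n" "q < n * n"
  shows "kronecker_mat (1\<^sub>m n) x $$ (p, q) =
    (if p div n = q div n then x $$ (p mod n, q mod n) else 0)"
  using assms by (auto simp: kronecker_mat_def less_mult_imp_div_less)

lemma kronecker_one_one: "kronecker_mat (1\<^sub>m n) (1\<^sub>m n :: complex mat) = 1\<^sub>m (n * n)"
proof (cases "n = 0")
  case False
  have "(p div n = q div n \<and> p mod n = q mod n) \<longleftrightarrow> p = q" for p q
    by (metis div_mult_mod_eq)
  thus ?thesis using False
    by (intro eq_matI) (auto simp: kronecker_one_index)
qed (auto simp: kronecker_mat_def)

lemma kronecker_one_mult:
  fixes x y :: "complex mat"
  assumes x: "x \<in> carrier_mat n n" and y: "y \<in> carrier_mat n n"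
  shows "kronecker_mat (1\<^sub>m n) x * kronecker_mat (1\<^sub>m n) y = kronecker_mat (1\<^sub>m n) (x * y)"
proof (rule eq_matI)
  fix p q assume "p < dim_row (kronecker_mat (1\<^sub>m n) (x * y))" "q < dim_col (kronecker_mat (1\<^sub>m n) (x * y))"
  hence pq: "p < n * n" "q < n * n" using x y by auto
  hence n: "n > 0" by (cases n) auto
  have lt: "p div n < n" "q div n < n" "p mod n < n" "q mod n < n"
    using pq n by (auto simp: less_mult_imp_div_less)
  have "(kronecker_mat (1\<^sub>m n) x * kronecker_mat (1\<^sub>m n) y) $$ (p, q)
     = (\<Sum>i<n * n. kronecker_mat (1\<^sub>m n) x $$ (p, i) * kronecker_mat (1\<^sub>m n) y $$ (i, q))"
    using pq x y by (simp add: scalar_prod_def atLeast0LessThan)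
  also have "\<dots> = (\<Sum>i<n * n. (\<lambda>a b. if a = p div n then
        if p div n = q div n then x $$ (p mod n, b) * y $$ (b, q mod n) else 0 else 0) (i div n) (i mod n))"
    using pq x y by (intro sum.cong refl) (auto simp: kronecker_one_index)
  also have "\<dots> = (\<Sum>a<n. \<Sum>b<n. if a = p div n then
        if p div n = q div n then x $$ (p mod n, b) * y $$ (b, q mod n) else 0 else 0)"
    by (rule sum_lessThan_divmod[OF n])
  also have "\<dots> = (\<Sum>a<n. if a = p div n then
        \<Sum>b<n. if p div n = q div n then x $$ (p mod n, b) * y $$ (b, q mod n) else 0 else 0)"
    by (intro sum.cong refl) auto
  also have "\<dots> = kronecker_mat (1\<^sub>m n) (x * y) $$ (p, q)"
    using pq x y lt by (simp add: kronecker_one_index scalar_prod_def atLeast0LessThan)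
  finally show "(kronecker_mat (1\<^sub>m n) x * kronecker_mat (1\<^sub>m n) y) $$ (p, q)
      = kronecker_mat (1\<^sub>m n) (x * y) $$ (p, q)" .
qed (use x y in auto)

lemma kronecker_one_power:
  fixes x :: "complex mat"
  assumes "x \<in> carrier_mat n n"
  shows "kronecker_mat (1\<^sub>m n) x ^\<^sub>m k = kronecker_mat (1\<^sub>m n) (x ^\<^sub>m k)"
  using assms by (induction k) (simp_all add: kronecker_one_one kronecker_one_mult)

lemma kronecker_one_adjoint:
  fixes x :: "complex mat"
  assumes "x \<in> carrier_mat n n"
  shows "mat_adjoint (kronecker_mat (1\<^sub>m n) x) = kronecker_mat (1\<^sub>m n) (mat_adjoint x)"
proof (rule eq_matI)
  fix p q assume "p < dim_row (kronecker_mat (1\<^sub>m n) (mat_adjoint x))"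
    "q < dim_col (kronecker_mat (1\<^sub>m n) (mat_adjoint x))"
  hence pq: "p < n * n" "q < n * n" using assms by auto
  hence n: "n > 0" by (cases n) auto
  have "mat_adjoint x \<in> carrier_mat n n" using assms by auto
  thus "mat_adjoint (kronecker_mat (1\<^sub>m n) x) $$ (p, q) = kronecker_mat (1\<^sub>m n) (mat_adjoint x) $$ (p, q)"
    using pq n assms by (auto simp: kronecker_one_index)
qed (use assms in auto)

lemma unitary_kronecker_one:
  assumes "unitary_mat n x"
  shows "unitary_mat (n * n) (kronecker_mat (1\<^sub>m n) x)"
proof -
  have x: "x \<in> carrier_mat n n" "mat_adjoint x \<in> carrier_mat n n"
    using assms by (auto simp: unitary_mat_def)
  show ?thesis using assms x
    by (simp add: unitary_mat_def kronecker_one_adjoint kronecker_one_mult kronecker_one_one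
        kronecker_mat_carrier)
qed

lemma trace_inner_kronecker_one:
  assumes x: "x \<in> carrier_mat n n" and y: "y \<in> carrier_mat n n"
  shows "trace_inner (kronecker_mat (1\<^sub>m n) x) (kronecker_mat (1\<^sub>m n) y) = of_nat n * trace_inner x y"
proof (cases "n = 0")
  case True
  thus ?thesis using x y by (simp add: trace_inner_def mat_trace_def)
next
  case False
  hence n: "n > 0" by simp
  let ?e = "\<lambda>b b'. x $$ (b, b') * cnj (y $$ (b, b'))"
  have "trace_inner (kronecker_mat (1\<^sub>m n) x) (kronecker_mat (1\<^sub>m n) y)
    = (\<Sum>p<n * n. \<Sum>q<n * n. kronecker_mat (1\<^sub>m n) x $$ (p, q) * cnj (kronecker_mat (1\<^sub>m n) y $$ (p, q)))"
    using x y by (intro trace_inner_entries) (auto intro: kronecker_mat_carrier)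
  also have "\<dots> = (\<Sum>p<n * n. \<Sum>q<n * n. (\<lambda>a' b'. if a' = p div n then ?e (p mod n) b' else 0) (q div n) (q mod n))"
    using x y by (intro sum.cong refl) (auto simp: kronecker_one_index)
  also have "\<dots> = (\<Sum>p<n * n. \<Sum>a'<n. \<Sum>b'<n. if a' = p div n then ?e (p mod n) b' else 0)"
    by (intro sum.cong refl sum_lessThan_divmod n)
  also have "\<dots> = (\<Sum>p<n * n. \<Sum>a'<n. if a' = p div n then \<Sum>b'<n. ?e (p mod n) b' else 0)"
    by (intro sum.cong refl) auto
  also have "\<dots> = (\<Sum>p<n * n. (\<lambda>a b. \<Sum>b'<n. ?e b b') (p div n) (p mod n))"
    by (rule sum.cong[OF refl]) (simp add: less_mult_imp_div_less)
  also have "\<dots> = (\<Sum>a<n. \<Sum>b<n. \<Sum>b'<n. ?e b b')"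
    by (rule sum_lessThan_divmod[OF n])
  finally show ?thesis using x y by (simp add: trace_inner_entries[of _ n])
qed

lemma combines_to_kronecker_one:
  assumes "combines_to n m x R X" "X \<in> carrier_mat n n" "\<And>c. R c \<in> carrier_mat n n"
  shows "combines_to (n * n) m x (\<lambda>c. kronecker_mat (1\<^sub>m n) (R c)) (kronecker_mat (1\<^sub>m n) X)"
  unfolding combines_to_def
proof (intro allI impI)
  fix p q assume pq: "p < n * n" "q < n * n"
  hence "n > 0" by (cases n) auto
  thus "kronecker_mat (1\<^sub>m n) X $$ (p, q) = (\<Sum>c<m. x c * kronecker_mat (1\<^sub>m n) (R c) $$ (p, q))"
    using assms pq by (simp add: kronecker_one_index combines_to_def)
qed

section \<open>Unitary pairs whose products are Fourier sums of an orthonormal basis\<close>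

text \<open>The offset \<open>s\<close> and the order \<open>d\<close> are independent of the size \<open>N\<close>: a summand of the block algebra
  has size \<open>N \<le> d\<close> and takes the exponents \<open>s, \<dots>, s + N - 1\<close> out of \<open>{0, \<dots>, d - 1}\<close>.\<close>

definition fourier_pair :: "nat \<Rightarrow> complex mat set \<Rightarrow> nat \<Rightarrow> nat \<Rightarrow> complex mat \<Rightarrow> complex mat
    \<Rightarrow> (nat \<Rightarrow> complex mat) \<Rightarrow> bool" where
  "fourier_pair N M d s U V R \<longleftrightarrow>
     U \<in> M \<and> V \<in> M \<and> unitary_mat N U \<and> unitary_mat N V \<and> orthonormal_frame N M R \<and>
     (\<forall>k. U ^\<^sub>m k * V ^\<^sub>m k \<in> M \<and>
          combines_to N N (\<lambda>c. cyc_char d k (s + c)) R (U ^\<^sub>m k * V ^\<^sub>m k))"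

text \<open>Passing from \<open>x\<close> to \<open>I\<^sub>n \<otimes> x\<close> multiplies the trace inner product by \<open>n\<close>, which cancels the squared
  norm \<open>1/n\<close> of the matrices \<open>P\<^sub>a Q\<^sub>b\<close>.\<close>

lemma fourier_pair_ampliation:
  assumes n: "n > 0"
  shows "\<exists>U V R. fourier_pair (n * n) (kronecker_mat (1\<^sub>m n) ` carrier_mat n n) d s U V R"
proof -
  define U where "U = mat_diag n (\<lambda>a. cyc_char d 1 (s + a))"
  define V where "V = fourier_multiplier n (\<lambda>b. cyc_char d 1 (b * n))"
  let ?K = "kronecker_mat (1\<^sub>m n) :: complex mat \<Rightarrow> _"
  have UV: "U \<in> carrier_mat n n" "V \<in> carrier_mat n n" by (simp_all add: U_def V_def)
  have "unitary_mat n U" "unitary_mat n V"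
    unfolding U_def V_def by (intro unitary_mat_diag unitary_fourier_multiplier cyc_char_cnj)+
  moreover have "?K U ^\<^sub>m k * ?K V ^\<^sub>m k = ?K (U ^\<^sub>m k * V ^\<^sub>m k)" for k
    using UV by (simp add: kronecker_one_power kronecker_one_mult pow_carrier_mat)
  moreover have "U ^\<^sub>m k * V ^\<^sub>m k \<in> carrier_mat n n"
    "combines_to n (n * n) (\<lambda>c. cyc_char d k (s + c)) (fourier_unit n) (U ^\<^sub>m k * V ^\<^sub>m k)" for k
    unfolding U_def V_def by (rule diag_fourier_powers)+
  moreover have "orthonormal_frame (n * n) (?K ` carrier_mat n n) (\<lambda>c. ?K (fourier_unit n c))"
    unfolding orthonormal_frame_def
  proof (intro conjI ballI)
    fix Y assume "Y \<in> ?K ` carrier_mat n n"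
    then obtain X where X: "X \<in> carrier_mat n n" "Y = ?K X" by blast
    obtain x where "combines_to n (n * n) x (fourier_unit n) X"
      using fourier_unit_spans[OF X(1)] by blast
    thus "\<exists>x. combines_to (n * n) (n * n) x (\<lambda>c. ?K (fourier_unit n c)) Y"
      unfolding X(2) 
      using combines_to_kronecker_one[where R = "fourier_unit n", OF _ X(1) fourier_unit_carrier] by blast
  qed (use n in \<open>auto simp: trace_inner_kronecker_one trace_inner_fourier_unit\<close>)
  ultimately have "fourier_pair (n * n) (?K ` carrier_mat n n) d s (?K U) (?K V) (\<lambda>c. ?K (fourier_unit n c))"
    using UV by (auto simp: fourier_pair_def unitary_kronecker_one combines_to_kronecker_one)
  thus ?thesis by blast
qed

section \<open>Direct sums\<close>

definition direct_sum_mat :: "complex mat \<Rightarrow> complex mat \<Rightarrow> complex mat" where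
  "direct_sum_mat A B = four_block_mat A (0\<^sub>m (dim_row A) (dim_col B)) (0\<^sub>m (dim_row B) (dim_col A)) B"

lemma direct_sum_carrier:
  "A \<in> carrier_mat a a \<Longrightarrow> B \<in> carrier_mat b b \<Longrightarrow> direct_sum_mat A B \<in> carrier_mat (a + b) (a + b)"
  by (auto simp: direct_sum_mat_def)

lemma direct_sum_index:
  assumes "A \<in> carrier_mat a a" "B \<in> carrier_mat b b" "p < a + b" "q < a + b"
  shows "direct_sum_mat A B $$ (p, q) =
    (if p < a \<and> q < a then A $$ (p, q) else if p \<ge> a \<and> q \<ge> a then B $$ (p - a, q - a) else 0)"
  using assms by (auto simp: direct_sum_mat_def)

lemma direct_sum_one: "direct_sum_mat (1\<^sub>m a) (1\<^sub>m b) = 1\<^sub>m (a + b)"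
  by (simp add: direct_sum_mat_def)

lemma direct_sum_mult:
  assumes "A \<in> carrier_mat a a" "B \<in> carrier_mat b b" "C \<in> carrier_mat a a" "D \<in> carrier_mat b b"
  shows "direct_sum_mat A B * direct_sum_mat C D = direct_sum_mat (A * C) (B * D)"
  using assms unfolding direct_sum_mat_def
  by (subst mult_four_block_mat[of _ a a _ b _ b _ _ a _ b]) auto

lemma direct_sum_power:
  assumes "A \<in> carrier_mat a a" "B \<in> carrier_mat b b"
  shows "direct_sum_mat A B ^\<^sub>m k = direct_sum_mat (A ^\<^sub>m k) (B ^\<^sub>m k)"
  using pow_four_block_mat[OF assms, of k] assms pow_carrier_mat[of A a k] pow_carrier_mat[of B b k]
  by (simp add: direct_sum_mat_def)

lemma direct_sum_adjoint:
  assumes "A \<in> carrier_mat a a" "B \<in> carrier_mat b b"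
  shows "mat_adjoint (direct_sum_mat A B) = direct_sum_mat (mat_adjoint A) (mat_adjoint B)"
  using assms by (intro eq_matI) (auto simp: direct_sum_mat_def)

lemma unitary_direct_sum:
  assumes "unitary_mat a A" "unitary_mat b B"
  shows "unitary_mat (a + b) (direct_sum_mat A B)"
proof -
  have "A \<in> carrier_mat a a" "mat_adjoint A \<in> carrier_mat a a"
    "B \<in> carrier_mat b b" "mat_adjoint B \<in> carrier_mat b b"
    using assms by (auto simp: unitary_mat_def)
  thus ?thesis using assms
    by (simp add: unitary_mat_def direct_sum_carrier direct_sum_adjoint[of A a B b]
        direct_sum_mult[of _ a _ b] direct_sum_one)
qed

lemma trace_inner_direct_sum:
  assumes "A \<in> carrier_mat a a" "B \<in> carrier_mat b b" "C \<in> carrier_mat a a" "D \<in> carrier_mat b b"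
  shows "trace_inner (direct_sum_mat A B) (direct_sum_mat C D) = trace_inner A C + trace_inner B D"
proof -
  have "trace_inner (direct_sum_mat A B) (direct_sum_mat C D)
    = (\<Sum>p<a + b. \<Sum>q<a + b. direct_sum_mat A B $$ (p, q) * cnj (direct_sum_mat C D $$ (p, q)))"
    using assms by (intro trace_inner_entries direct_sum_carrier)
  also have "\<dots> = trace_inner A C + trace_inner B D"
    using assms
    by (simp add: sum_lessThan_add direct_sum_index[of _ a _ b] trace_inner_entries[of _ a]
        trace_inner_entries[of _ b])
  finally show ?thesis .
qed

definition join_frames :: "nat \<Rightarrow> nat \<Rightarrow> (nat \<Rightarrow> complex mat) \<Rightarrow> (nat \<Rightarrow> complex mat) \<Rightarrow> nat \<Rightarrow> complex mat" where
  "join_frames a b R S c =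
     (if c < a then direct_sum_mat (R c) (0\<^sub>m b b) else direct_sum_mat (0\<^sub>m a a) (S (c - a)))"

lemma combines_to_direct_sum:
  assumes A: "combines_to a a x R A" "A \<in> carrier_mat a a" "\<And>c. c < a \<Longrightarrow> R c \<in> carrier_mat a a"
    and B: "combines_to b b (\<lambda>c. x (a + c)) S B" "B \<in> carrier_mat b b" "\<And>c. c < b \<Longrightarrow> S c \<in> carrier_mat b b"
  shows "combines_to (a + b) (a + b) x (join_frames a b R S) (direct_sum_mat A B)"
  unfolding combines_to_def
proof (intro allI impI)
  fix p q assume pq: "p < a + b" "q < a + b"
  have "(\<Sum>c<a + b. x c * join_frames a b R S c $$ (p, q))
     = (\<Sum>c<a. x c * (if p < a \<and> q < a then R c $$ (p, q) else 0))
     + (\<Sum>c<b. x (a + c) * (if p \<ge> a \<and> q \<ge> a then S c $$ (p - a, q - a) else 0))"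
    unfolding sum_lessThan_add using pq A(3) B(3)
    by (intro arg_cong2[of _ _ _ _ "(+)"] sum.cong refl)
      (auto simp: join_frames_def direct_sum_index[of _ a _ b])
  also have "\<dots> = direct_sum_mat A B $$ (p, q)"
    using A B pq by (auto simp: direct_sum_index[of _ a _ b] combines_to_def)
  finally show "direct_sum_mat A B $$ (p, q) = (\<Sum>c<a + b. x c * join_frames a b R S c $$ (p, q))" ..
qed

lemma orthonormal_frame_direct_sum:
  assumes R: "orthonormal_frame a M R" "M \<subseteq> carrier_mat a a" "0\<^sub>m a a \<in> M"
    and S: "orthonormal_frame b M' S" "M' \<subseteq> carrier_mat b b" "0\<^sub>m b b \<in> M'"
  shows "orthonormal_frame (a + b) {direct_sum_mat A B | A B. A \<in> M \<and> B \<in> M'} (join_frames a b R S)"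
proof -
  have Rc: "R c \<in> M" "R c \<in> carrier_mat a a" if "c < a" for c
    using R that by (auto simp: orthonormal_frame_def)
  have Sc: "S c \<in> M'" "S c \<in> carrier_mat b b" if "c < b" for c
    using S that by (auto simp: orthonormal_frame_def)
  have zero: "trace_inner (0\<^sub>m m m) X = 0" "trace_inner X (0\<^sub>m m m) = 0"
    if "X \<in> carrier_mat m m" for m and X :: "complex mat"
    using that by (simp_all add: trace_inner_entries[of _ m])
  have "join_frames a b R S c \<in> {direct_sum_mat A B | A B. A \<in> M \<and> B \<in> M'}" if "c < a + b" for c
    using that R(3) S(3) Rc[of c] Sc[of "c - a"] by (force simp: join_frames_def)
  moreover have "trace_inner (join_frames a b R S c) (join_frames a b R S c') = (if c = c' then 1 else 0)"
    if "c < a + b" "c' < a + b" for c c'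
    using that R(1) S(1) Rc Sc
    by (auto simp: join_frames_def trace_inner_direct_sum[of _ a _ b] zero orthonormal_frame_def)
  moreover have "\<exists>x. combines_to (a + b) (a + b) x (join_frames a b R S) (direct_sum_mat A B)"
    if "A \<in> M" "B \<in> M'" for A B
  proof -
    have "\<exists>x. combines_to a a x R A" "\<exists>y. combines_to b b y S B"
      using that R(1) S(1) by (simp_all add: orthonormal_frame_def)
    then obtain x y where "combines_to a a x R A" "combines_to b b y S B" by blast
    hence "combines_to (a + b) (a + b) (\<lambda>c. if c < a then x c else y (c - a)) (join_frames a b R S)
        (direct_sum_mat A B)"
      using that R(2) S(2) Rc(2) Sc(2)
      by (intro combines_to_direct_sum) (auto simp: combines_to_def)
    thus ?thesis by blast
  qed
  ultimately show ?thesis by (auto simp: orthonormal_frame_def)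
qed

text \<open>The second pair starts at the offset where the first one stops, so the joined frame carries
  consecutive exponents.\<close>

lemma fourier_pair_direct_sum:
  assumes P: "fourier_pair a M d s U V R" "M \<subseteq> carrier_mat a a" "0\<^sub>m a a \<in> M"
    and Q: "fourier_pair b M' d (s + a) U' V' S" "M' \<subseteq> carrier_mat b b" "0\<^sub>m b b \<in> M'"
  shows "fourier_pair (a + b) {direct_sum_mat A B | A B. A \<in> M \<and> B \<in> M'} d s
    (direct_sum_mat U U') (direct_sum_mat V V') (join_frames a b R S)"
proof -
  have U: "U \<in> carrier_mat a a" "V \<in> carrier_mat a a" "U' \<in> carrier_mat b b" "V' \<in> carrier_mat b b"
    using P Q by (auto simp: fourier_pair_def)
  have pow: "direct_sum_mat U U' ^\<^sub>m k * direct_sum_mat V V' ^\<^sub>m k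
      = direct_sum_mat (U ^\<^sub>m k * V ^\<^sub>m k) (U' ^\<^sub>m k * V' ^\<^sub>m k)" for k
    using U by (simp add: direct_sum_power[of _ a _ b] direct_sum_mult[of _ a _ b] pow_carrier_mat)
  have fr: "orthonormal_frame a M R" "orthonormal_frame b M' S"
    using P Q by (auto simp: fourier_pair_def)
  have "combines_to (a + b) (a + b) (\<lambda>c. cyc_char d k (s + c)) (join_frames a b R S)
      (direct_sum_mat (U ^\<^sub>m k * V ^\<^sub>m k) (U' ^\<^sub>m k * V' ^\<^sub>m k))" for k
    using P Q fr by (intro combines_to_direct_sum)
      (auto simp: fourier_pair_def orthonormal_frame_def add.assoc)
  moreover have "direct_sum_mat (U ^\<^sub>m k * V ^\<^sub>m k) (U' ^\<^sub>m k * V' ^\<^sub>m k)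
      \<in> {direct_sum_mat A B | A B. A \<in> M \<and> B \<in> M'}" for k
    using P(1) Q(1) unfolding fourier_pair_def by blast
  ultimately show ?thesis
    unfolding fourier_pair_def pow
    using P Q orthonormal_frame_direct_sum[OF fr(1) P(2,3) fr(2) Q(2,3)]
    by (auto simp: fourier_pair_def intro: unitary_direct_sum)
qed

lemma block_algebra_Cons_direct_sum:
  "block_algebra (n # ns) =
    {direct_sum_mat A B | A B. A \<in> kronecker_mat (1\<^sub>m n) ` carrier_mat n n \<and> B \<in> block_algebra ns}"
proof -
  have "block_algebra (n # ns) =
      (\<Union>x\<in>carrier_mat n n. \<Union>B\<in>block_algebra ns. {direct_sum_mat (kronecker_mat (1\<^sub>m n) x) B})"
    unfolding block_algebra_Cons by (intro SUP_cong refl) (simp add: direct_sum_mat_def)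
  also have "\<dots> = {direct_sum_mat A B | A B. A \<in> kronecker_mat (1\<^sub>m n) ` carrier_mat n n
      \<and> B \<in> block_algebra ns}" by blast
  finally show ?thesis .
qed

lemma fourier_pair_block_algebra:
  assumes "\<forall>n\<in>set ns. n > 0"
  shows "\<exists>U V R. fourier_pair (\<Sum>n\<leftarrow>ns. n\<^sup>2) (block_algebra ns) d s U V R"
  using assms
proof (induction ns arbitrary: s)
  case Nil
  have "fourier_pair 0 {0\<^sub>m 0 0} d s (0\<^sub>m 0 0) (0\<^sub>m 0 0) R" for R
    by (auto simp: fourier_pair_def unitary_mat_def orthonormal_frame_def combines_to_def)
  thus ?case by (auto simp: block_algebra_Nil)
next
  case (Cons n ns)
  let ?K = "kronecker_mat (1\<^sub>m n) ` carrier_mat n n :: complex mat set"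
  obtain U V R where P: "fourier_pair (n * n) ?K d s U V R"
    using fourier_pair_ampliation[of n d s] Cons.prems by auto
  obtain U' V' S where Q: "fourier_pair (\<Sum>n\<leftarrow>ns. n\<^sup>2) (block_algebra ns) d (s + n * n) U' V' S"
    using Cons.IH[of "s + n * n"] Cons.prems by auto
  have "?K \<subseteq> carrier_mat (n * n) (n * n)" by (auto intro: kronecker_mat_carrier)
  moreover have "0\<^sub>m (n * n) (n * n) \<in> ?K"
    using kronecker_one_zero[of n] by (metis image_eqI zero_carrier_mat)
  ultimately show ?case
    using fourier_pair_direct_sum[OF P _ _ Q block_algebra_carrier block_algebra_zero]
    by (auto simp: block_algebra_Cons_direct_sum power2_eq_square)
qed

theorem theorem2p2:
  fixes ns :: "nat list" and d :: nat
  assumes "length ns \<ge> 1"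
    and "\<forall>n\<in>set ns. n > 0"
    and "d = (\<Sum>n\<leftarrow>ns. n\<^sup>2)"
  shows "\<exists>U\<in>block_algebra ns. \<exists>V\<in>block_algebra ns.
    unitary_mat d U \<and> unitary_mat d V \<and>
    trace_orthogonal_basis d (block_algebra ns) {0..<d} (\<lambda>k. U ^\<^sub>m k * V ^\<^sub>m k)"
proof -
  obtain U V R where "fourier_pair d (block_algebra ns) d 0 U V R"
    using fourier_pair_block_algebra[OF assms(2)] unfolding assms(3) by blast
  moreover from this
  have "trace_orthogonal_basis d (block_algebra ns) {0..<d} (\<lambda>k. U ^\<^sub>m k * V ^\<^sub>m k)"
    using block_algebra_carrier[of ns] vectorspace_block_algebra[OF assms(3)] assms(3)
    by (intro fourier_transform_orthogonal_basis[of _ _ R]) (auto simp: fourier_pair_def)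
  ultimately show ?thesis by (auto simp: fourier_pair_def)
qed

end
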